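(* Let $\varepsilon:\mathbb{R}\to\mathbb{R}$ satisfy Assumption A1 of the context with constant $\underline{\varepsilon}>0$, let $n\in\mathbb{N}$, $\gamma_1,\dots,\gamma_n\in\mathbb{R}$, let $M,m_1,m_o>0$ and $k_1,k_o\ge0$, and set $$\lambda_1:=\frac{2(m_1+k_1)+|\gamma_1|}{2\underline{\varepsilon}},\qquad \lambda_o:=\frac{2(m_o+k_o)+|\gamma_1|}{2\underline{\varepsilon}},\qquad \mu:=\frac{1}{\underline{\varepsilon}}\left(\frac{|\gamma_1|}{2}+\sum_{i=2}^{n}\frac{|\gamma_i|M^{i-2}}{i+2}\right).$$ Let the feedback laws $v_1,v_o:\mathbb{R}\to\mathbb{R}$ be defined by $$v_1(u(1)):=-\lambda_1u(1)-\mu u(1)^3,\qquad v_o(u(0)):=\lambda_ou(0)+\mu u(0)^3.$$ Then the maps $v_o$ and $v_1$ are invertible; that is, there exist maps $d_o:\mathbb{R}\to\mathbb{R}$ and $d_1:\mathbb{R}\to\mathbb{R}$ such that, given any solution $u$ to the system $\Sigma$ of the context, $$u_x(0)=v_o(u(0))\Leftrightarrow u(0)=d_o(u_x(0)),\qquad\text{and}\qquad u_x(1)=v_1(u(1))\Leftrightarrow u(1)=d_1(u_x(1)).$$ In particular: (i) if $\mu=0$, then $$d_1(u_x(1)):=-\frac{u_x(1)}{\lambda_1},\qquad d_o(u_x(0)):=\frac{u_x(0)}{\lambda_o};$$ (ii) otherwise, $$d_1(u_x(1)):=\sqrt[3]{-\frac{u_x(1)}{2\lambda_1}+\sqrt{\frac{u_x(1)^2}{4\lambda_1^2}+\frac{\lambda_1^3}{27\mu^3}}}+\sqrt[3]{-\frac{u_x(1)}{2\lambda_1}-\sqrt{\frac{u_x(1)^2}{4\lambda_1^2}+\frac{\lambda_1^3}{27\mu^3}}},$$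 $$d_o(u_x(0)):=\sqrt[3]{\frac{u_x(0)}{2\lambda_o}+\sqrt{\frac{u_x(0)^2}{4\lambda_o^2}+\frac{\lambda_o^3}{27\mu^3}}}+\sqrt[3]{\frac{u_x(0)}{2\lambda_o}-\sqrt{\frac{u_x(0)^2}{4\lambda_o^2}+\frac{\lambda_o^3}{27\mu^3}}}.$$
   Context: $\sqrt[3]{\cdot}$ denotes the real cube root on $\mathbb{R}$. Assumption A1. $\varepsilon$ is differentiable; there exists a continuous non-decreasing map $\bar\varepsilon':\mathbb{R}_{\ge0}\to\mathbb{R}_{\ge0}$ such that $\sup_{u\in[-s,s]}|\varepsilon'(u)|\le\bar\varepsilon'(s)$ for every $s\ge0$; and there exists a constant $\underline{\varepsilon}>0$ such that $\underline{\varepsilon}\le\varepsilon(u)$ for all $u\in\mathbb{R}$. System $\Sigma$: for the state $u=u(x,t)\in\mathbb{R}$, with $x\in[0,1]$, $t\ge0$, and $p\in(1,+\infty)$, $$u_t=\varepsilon(u)u_{xx}+\sum_{i=1}^n\gamma_iu^iu_x+u^p,$$ with Neumann-type boundary conditions $u_x(0)=v_o(u(0))$, $u_x(1)=v_1(u(1))$ and initial condition $u(x,0)=u_o(x)$. Here subscripts $x,t$ denote partial derivatives, and $u(0),u(1),u_x(0),u_x(1)$ denote the values of $u$ and $u_x$ at $x=0$ and $x=1$ at time $t$. The initial condition $u_o:[0,1]\to\mathbb{R}$ is twice continuously differentiable with $u_o''$ Hölder continuous with exponent $\beta$, for some $\beta\in(0,1)$. Solutions: a (classical) solution to $\Sigma$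 on $[0,T)$, $T\in(0,+\infty]$, is a map $u:[0,1]\times[0,T)\to\mathbb{R}$ such that, on any bounded subset $[0,1]\times L\subset[0,1]\times[0,T)$, $u_{xx}$ and $u_t$ are Hölder continuous in $x$ with exponent $\beta$ uniformly in $t$ and Hölder continuous in $t$ with exponent $\beta/2$ uniformly in $x$, and which satisfies the equation for all $(x,t)\in(0,1)\times(0,T)$, the boundary conditions for all $t\in[0,T)$, and the initial condition for all $x\in[0,1]$.
   Formalization: In (ii) the printed denominators 2λ and 4λ² under the cube roots are corrected to 2μ and 4μ² (for both d_1 and d_o), since the printed formula is not the inverse unless λ=μ or the argument is 0 (e.g. λ=1, μ=2, v_o(1)=3). *)

theory Defs
  imports "HOL-Analysis.Analysis"
begin

definition assumption_A1 :: "(real \<Rightarrow> real) \<Rightarrow> real \<Rightarrow> bool" where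
  "assumption_A1 eps eps_low \<longleftrightarrow>
     (\<forall>u. eps differentiable (at u)) \<and>
     (\<exists>eps_bar' :: real \<Rightarrow> real.
        continuous_on {0..} eps_bar' \<and> mono_on {0..} eps_bar' \<and>
        (\<forall>s\<ge>0. 0 \<le> eps_bar' s) \<and>
        (\<forall>s\<ge>0. (SUP u\<in>{-s..s}. ereal \<bar>deriv eps u\<bar>) \<le> ereal (eps_bar' s))) \<and>
     0 < eps_low \<and> (\<forall>u. eps_low \<le> eps u)"

definition holder_on :: "real set \<Rightarrow> real \<Rightarrow> (real \<Rightarrow> real) \<Rightarrow> bool" where
  "holder_on S \<beta> f \<longleftrightarrow>
     (\<exists>C. \<forall>x\<in>S. \<forall>y\<in>S. \<bar>f x - f y\<bar> \<le> C * \<bar>x - y\<bar> powr \<beta>)"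

definition initial_datum :: "real \<Rightarrow> (real \<Rightarrow> real) \<Rightarrow> bool" where
  "initial_datum \<beta> u0 \<longleftrightarrow>
     (\<exists>u0' u0''.
        (\<forall>x\<in>{0..1}. (u0 has_real_derivative u0' x) (at x within {0..1})) \<and>
        (\<forall>x\<in>{0..1}. (u0' has_real_derivative u0'' x) (at x within {0..1})) \<and>
        continuous_on {0..1} u0'' \<and> holder_on {0..1} \<beta> u0'')"

text \<open>The state may be negative, while \<open>powr\<close> is the real power only for
  nonnegative bases. The relation below also covers negative bases when the exponent
  is a fraction with odd denominator (in particular a natural number), using that
  \<open>root b\<close> is the real odd root. For a negative base and any other
  exponent the power does not exist, and the equation cannot hold.\<close>

definition is_real_power :: "real \<Rightarrow> real \<Rightarrow> real \<Rightarrow> bool" where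
  "is_real_power x p r \<longleftrightarrow>
     (0 \<le> x \<and> r = x powr p) \<or>
     (\<exists>a b :: nat. odd b \<and> p = real a / real b \<and> r = root b (x ^ a))"

definition time_dom :: "ereal \<Rightarrow> real set" where
  "time_dom T = {t. 0 \<le> t \<and> ereal t < T}"

text \<open>Derivatives are relative to the domain, hence one-sided at
  \<open>x = 0\<close>, \<open>x = 1\<close> and \<open>t = 0\<close>.\<close>

definition dx :: "(real \<Rightarrow> real \<Rightarrow> real) \<Rightarrow> real \<Rightarrow> real \<Rightarrow> real" where
  "dx u x t = vector_derivative (\<lambda>y. u y t) (at x within {0..1})"

definition dt :: "ereal \<Rightarrow> (real \<Rightarrow> real \<Rightarrow> real) \<Rightarrow> real \<Rightarrow> real \<Rightarrow> real" where
  "dt T u x t = vector_derivative (\<lambda>s. u x s) (at t within time_dom T)"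

definition holder_x_unif :: "real set \<Rightarrow> real \<Rightarrow> (real \<Rightarrow> real \<Rightarrow> real) \<Rightarrow> bool" where
  "holder_x_unif L \<alpha> f \<longleftrightarrow>
     (\<exists>C. \<forall>t\<in>L. \<forall>x\<in>{0..1}. \<forall>y\<in>{0..1}. \<bar>f x t - f y t\<bar> \<le> C * \<bar>x - y\<bar> powr \<alpha>)"

definition holder_t_unif :: "real set \<Rightarrow> real \<Rightarrow> (real \<Rightarrow> real \<Rightarrow> real) \<Rightarrow> bool" where
  "holder_t_unif L \<alpha> f \<longleftrightarrow>
     (\<exists>C. \<forall>x\<in>{0..1}. \<forall>s\<in>L. \<forall>t\<in>L. \<bar>f x s - f x t\<bar> \<le> C * \<bar>s - t\<bar> powr \<alpha>)"

definition classical_regularity :: "real \<Rightarrow> ereal \<Rightarrow> (real \<Rightarrow> real \<Rightarrow> real) \<Rightarrow> bool" where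
  "classical_regularity \<beta> T u \<longleftrightarrow>
     (\<forall>x\<in>{0..1}. \<forall>t\<in>time_dom T.
        (\<lambda>y. u y t) differentiable (at x within {0..1}) \<and>
        (\<lambda>y. dx u y t) differentiable (at x within {0..1}) \<and>
        (\<lambda>s. u x s) differentiable (at t within time_dom T)) \<and>
     (\<forall>L. L \<subseteq> time_dom T \<and> bounded L \<longrightarrow>
        holder_x_unif L \<beta> (dx (dx u)) \<and> holder_t_unif L (\<beta> / 2) (dx (dx u)) \<and>
        holder_x_unif L \<beta> (dt T u) \<and> holder_t_unif L (\<beta> / 2) (dt T u))"

definition is_solution ::
  "(real \<Rightarrow> real) \<Rightarrow> nat \<Rightarrow> (nat \<Rightarrow> real) \<Rightarrow> real \<Rightarrow> (real \<Rightarrow> real) \<Rightarrow> (real \<Rightarrow> real) \<Rightarrow>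
   real \<Rightarrow> (real \<Rightarrow> real) \<Rightarrow> ereal \<Rightarrow> (real \<Rightarrow> real \<Rightarrow> real) \<Rightarrow> bool" where
  "is_solution eps n \<gamma> p v_o v_1 \<beta> u0 T u \<longleftrightarrow>
     classical_regularity \<beta> T u \<and>
     (\<forall>x\<in>{0<..<1}. \<forall>t\<in>time_dom T. 0 < t \<longrightarrow>
        (\<exists>r. is_real_power (u x t) p r \<and>
             dt T u x t = eps (u x t) * dx (dx u) x t
                          + (\<Sum>i=1..n. \<gamma> i * u x t ^ i * dx u x t) + r)) \<and>
     (\<forall>t\<in>time_dom T. dx u 0 t = v_o (u 0 t) \<and> dx u 1 t = v_1 (u 1 t)) \<and>
     (\<forall>x\<in>{0..1}. u x 0 = u0 x)"

text \<open>Explicit inverses. For \<open>\<mu> > 0\<close> the equation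
  \<open>\<lambda> * y + \<mu> * y ^ 3 = w\<close> is the depressed cubic
  \<open>y ^ 3 + (\<lambda> / \<mu>) * y - w / \<mu> = 0\<close>, so that Cardano's
  radicands contain \<open>w / (2 * \<mu>)\<close> and
  \<open>w\<^sup>2 / (4 * \<mu>\<^sup>2)\<close>. The source prints \<open>\<lambda>\<close>
  in place of \<open>\<mu>\<close> in these two denominators. The theorem states the
  corrected formula: the printed expression solves
  \<open>y ^ 3 + (\<lambda> / \<mu>) * y = w / \<lambda>\<close> instead, and for
  \<open>w \<noteq> 0\<close> and \<open>\<lambda> \<noteq> \<mu>\<close> it is not the
  value of the inverse.\<close>

end

theory Submission
  imports Defs
begin

text \<open>For \<open>\<mu> > 0\<close>, write \<open>a\<close> and \<open>b\<close> for the two cube roots in the formula. Then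
  \<open>a ^ 3 + b ^ 3 = w / \<mu>\<close>, and \<open>(a * b) ^ 3\<close> is the difference of squares
  \<open>- (c / (3 * \<mu>)) ^ 3\<close>, so \<open>a * b = - c / (3 * \<mu>)\<close> because real cube roots are unique.
  Expanding \<open>(a + b) ^ 3\<close> shows that \<open>a + b\<close> solves the cubic. The boundary laws are strictly
  monotone, so these right inverses are two-sided.\<close>

text \<open>Cardano's formula for the real root of \<open>c * y + \<mu> * y ^ 3 = w\<close>. The
  linear case is split off because, with division by zero equal to zero, the radicals would collapse
  to 0 at \<open>\<mu> = 0\<close>.\<close>

definition cubic_inverse :: "real \<Rightarrow> real \<Rightarrow> real \<Rightarrow> real" where
  "cubic_inverse c \<mu> w =
     (if \<mu> = 0 then w / c
      else root 3 (w / (2 * \<mu>) + sqrt (w\<^sup>2 / (4 * \<mu>\<^sup>2) + c ^ 3 / (27 * \<mu> ^ 3))) +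
           root 3 (w / (2 * \<mu>) - sqrt (w\<^sup>2 / (4 * \<mu>\<^sup>2) + c ^ 3 / (27 * \<mu> ^ 3))))"

lemma cubic_cubic_inverse:
  fixes c \<mu> w :: real
  assumes "0 < c" "0 \<le> \<mu>"
  shows "c * cubic_inverse c \<mu> w + \<mu> * cubic_inverse c \<mu> w ^ 3 = w"
proof (cases "\<mu> = 0")
  case True
  then show ?thesis using assms by (simp add: cubic_inverse_def)
next
  case False
  then have "0 < \<mu>" using assms by simp
  define q s where "q = w / (2 * \<mu>)"
    and "s = sqrt (w\<^sup>2 / (4 * \<mu>\<^sup>2) + c ^ 3 / (27 * \<mu> ^ 3))"
  define a b where "a = root 3 (q + s)" and "b = root 3 (q - s)"
  have y: "cubic_inverse c \<mu> w = a + b"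
    using False by (simp add: cubic_inverse_def a_def b_def q_def s_def)
  \<comment> \<open>The signs of \<open>c\<close> and \<open>\<mu>\<close> make the radicand
    nonnegative, so that squaring \<open>s\<close> really removes the square root; this is the case
    of Cardano's formula with real radicals.\<close>
  have "0 \<le> w\<^sup>2 / (4 * \<mu>\<^sup>2) + c ^ 3 / (27 * \<mu> ^ 3)"
    using assms by (intro add_nonneg_nonneg divide_nonneg_nonneg) auto
  then have s2: "s\<^sup>2 = q\<^sup>2 + c ^ 3 / (27 * \<mu> ^ 3)"
    by (simp add: s_def q_def power_divide power_mult_distrib)
  have a3: "a ^ 3 = q + s" and b3: "b ^ 3 = q - s"
    by (simp_all add: a_def b_def odd_real_root_pow)
  have "(a * b) ^ 3 = q\<^sup>2 - s\<^sup>2"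
    by (simp add: power_mult_distrib a3 b3 power2_eq_square algebra_simps)
  also have "\<dots> = (- c / (3 * \<mu>)) ^ 3"
    by (simp add: s2 power_divide power_mult_distrib)
  finally have cubes: "(a * b) ^ 3 = (- c / (3 * \<mu>)) ^ 3" .
  have "a * b = root 3 ((a * b) ^ 3)"
    by (rule odd_real_root_power_cancel[symmetric]) simp
  also have "\<dots> = - c / (3 * \<mu>)"
    unfolding cubes by (rule odd_real_root_power_cancel) simp
  finally have ab: "a * b = - c / (3 * \<mu>)" .
  have "(a + b) ^ 3 = a ^ 3 + b ^ 3 + 3 * (a * b) * (a + b)"
    by (simp add: power3_eq_cube algebra_simps)
  also have "\<dots> = w / \<mu> - c / \<mu> * (a + b)"
    unfolding a3 b3 ab using \<open>0 < \<mu>\<close> by (simp add: q_def field_simps)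
  finally show ?thesis
    unfolding y using \<open>0 < \<mu>\<close> by (simp add: field_simps)
qed

text \<open>The linear term alone supplies strictness and the cube is only used as weakly
  increasing, so \<open>\<mu> = 0\<close> is covered too.\<close>

lemma strict_mono_cubic:
  fixes c \<mu> :: real
  assumes "0 < c" "0 \<le> \<mu>"
  shows "strict_mono (\<lambda>y. c * y + \<mu> * y ^ 3)"
proof (rule strict_monoI)
  fix x y :: real
  assume "x < y"
  then have "x ^ 3 \<le> y ^ 3" by (intro power_mono_odd) auto
  with \<open>x < y\<close> assms show "c * x + \<mu> * x ^ 3 < c * y + \<mu> * y ^ 3"
    by (intro add_less_le_mono mult_strict_left_mono mult_left_mono) auto
qed

text \<open>An injective map with a right inverse has it as left inverse: solve the cubic for its
  own value at \<open>y\<close>, then cancel by strict monotonicity.\<close>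

lemma cubic_inverse_cubic:
  fixes c \<mu> y :: real
  assumes "0 < c" "0 \<le> \<mu>"
  shows "cubic_inverse c \<mu> (c * y + \<mu> * y ^ 3) = y"
  using cubic_cubic_inverse[OF assms, of "c * y + \<mu> * y ^ 3"]
  by (rule strict_mono_eq[OF strict_mono_cubic[OF assms], THEN iffD1])

theorem proposition1:
  fixes eps :: "real \<Rightarrow> real" and eps_low :: real
    and n :: nat and \<gamma> :: "nat \<Rightarrow> real"
    and M m_1 m_o k_1 k_o :: real
    and lambda_1 lambda_o \<mu> :: real
    and v_1 v_o :: "real \<Rightarrow> real"
  assumes A1: "assumption_A1 eps eps_low"
    and "0 < M" and "0 < m_1" and "0 < m_o" and "0 \<le> k_1" and "0 \<le> k_o"
    and lambda_1: "lambda_1 = (2 * (m_1 + k_1) + \<bar>\<gamma> 1\<bar>) / (2 * eps_low)"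
    and lambda_o: "lambda_o = (2 * (m_o + k_o) + \<bar>\<gamma> 1\<bar>) / (2 * eps_low)"
    and mu: "\<mu> = 1 / eps_low *
              (\<bar>\<gamma> 1\<bar> / 2 + (\<Sum>i=2..n. \<bar>\<gamma> i\<bar> * M ^ (i - 2) / (real i + 2)))"
    and v_1: "\<And>y. v_1 y = - lambda_1 * y - \<mu> * y ^ 3"
    and v_o: "\<And>y. v_o y = lambda_o * y + \<mu> * y ^ 3"
  shows "\<exists>d_o d_1 :: real \<Rightarrow> real.
    (d_o \<circ> v_o = id \<and> v_o \<circ> d_o = id) \<and>
    (d_1 \<circ> v_1 = id \<and> v_1 \<circ> d_1 = id) \<and>
    (\<forall>p \<beta> u0 T u.
       1 < p \<and> 0 < \<beta> \<and> \<beta> < 1 \<and> initial_datum \<beta> u0 \<and> 0 < T \<and>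
       is_solution eps n \<gamma> p v_o v_1 \<beta> u0 T u \<longrightarrow>
       (\<forall>t\<in>time_dom T.
          (dx u 0 t = v_o (u 0 t) \<longleftrightarrow> u 0 t = d_o (dx u 0 t)) \<and>
          (dx u 1 t = v_1 (u 1 t) \<longleftrightarrow> u 1 t = d_1 (dx u 1 t)))) \<and>
    (\<mu> = 0 \<longrightarrow>
       (\<forall>w. d_1 w = - w / lambda_1) \<and> (\<forall>w. d_o w = w / lambda_o)) \<and>
    (\<mu> \<noteq> 0 \<longrightarrow>
       (\<forall>w. d_1 w =
          root 3 (- w / (2 * \<mu>) + sqrt (w\<^sup>2 / (4 * \<mu>\<^sup>2) + lambda_1 ^ 3 / (27 * \<mu> ^ 3))) +
          root 3 (- w / (2 * \<mu>) - sqrt (w\<^sup>2 / (4 * \<mu>\<^sup>2) + lambda_1 ^ 3 / (27 * \<mu> ^ 3)))) \<and>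
       (\<forall>w. d_o w =
          root 3 (w / (2 * \<mu>) + sqrt (w\<^sup>2 / (4 * \<mu>\<^sup>2) + lambda_o ^ 3 / (27 * \<mu> ^ 3))) +
          root 3 (w / (2 * \<mu>) - sqrt (w\<^sup>2 / (4 * \<mu>\<^sup>2) + lambda_o ^ 3 / (27 * \<mu> ^ 3)))))"
proof -
  have eps: "0 < eps_low" using A1 by (simp add: assumption_A1_def)
  \<comment> \<open>Positivity of \<open>m_1\<close> and \<open>m_o\<close> keeps both gains
    positive even if the other summands vanish.\<close>
  have l1: "0 < lambda_1" and lo: "0 < lambda_o"
    unfolding lambda_1 lambda_o using eps assms(3-6)
    by (auto intro!: divide_pos_pos add_pos_nonneg)
  \<comment> \<open>Only the weak inequality is available: \<open>\<mu>\<close> vanishes when all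
    \<open>\<gamma> i\<close> do.\<close>
  have "0 \<le> \<mu>"
    unfolding mu using eps \<open>0 < M\<close>
    by (intro mult_nonneg_nonneg add_nonneg_nonneg sum_nonneg divide_nonneg_nonneg) auto
  \<comment> \<open>The law \<open>v_1\<close> is the negative of an increasing cubic, hence the
    argument \<open>- w\<close> in \<open>d_1\<close>.\<close>
  define d_o d_1 where "d_o = cubic_inverse lambda_o \<mu>"
    and "d_1 = (\<lambda>w. cubic_inverse lambda_1 \<mu> (- w))"
  have o_left: "d_o (v_o y) = y" and o_right: "v_o (d_o y) = y" for y
    unfolding d_o_def v_o
    by (rule cubic_inverse_cubic[OF lo \<open>0 \<le> \<mu>\<close>] cubic_cubic_inverse[OF lo \<open>0 \<le> \<mu>\<close>])+
  have "v_1 y = - (lambda_1 * y + \<mu> * y ^ 3)" for y by (simp add: v_1)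
  then have i_left: "d_1 (v_1 y) = y" and i_right: "v_1 (d_1 y) = y" for y
    unfolding d_1_def
    by (simp_all only: minus_minus cubic_inverse_cubic[OF l1 \<open>0 \<le> \<mu>\<close>]
        cubic_cubic_inverse[OF l1 \<open>0 \<le> \<mu>\<close>])
  \<comment> \<open>These hold for arbitrary reals; taking \<open>w\<close> as the boundary slope
    and \<open>y\<close> as the boundary value yields the equivalences along solutions.\<close>
  have iff_o: "w = v_o y \<longleftrightarrow> y = d_o w" and iff_1: "w = v_1 y \<longleftrightarrow> y = d_1 w" for w y
    using o_left o_right i_left i_right by metis+
  show ?thesis
  proof (rule exI[of _ d_o], rule exI[of _ d_1], intro conjI allI impI ballI)
    show "d_o \<circ> v_o = id" "v_o \<circ> d_o = id" "d_1 \<circ> v_1 = id" "v_1 \<circ> d_1 = id"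
      by (simp_all add: fun_eq_iff o_left o_right i_left i_right)
  \<comment> \<open>Replacing \<open>w\<close> by \<open>- w\<close> leaves the square under the
    root unchanged, so only the linear terms of \<open>d_1\<close> carry the sign.\<close>
  qed (rule iff_o iff_1 | simp add: d_o_def d_1_def cubic_inverse_def)+
qed

end
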